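(* Let every point of the Euclidean space $\mathbb{E}^3$ be coloured either red or blue so that there are no two red points at distance $1$ apart. Then there exist five blue points that form an $\ell_5$.
   Context: $\mathbb{E}^3$ is three-dimensional Euclidean space with the usual distance. For a positive integer $i$, $\ell_i$ denotes a configuration of $i$ collinear points with distance $1$ between any two consecutive points, i.e. a set of points $p, p+v, p+2v, \dots, p+(i-1)v$ with $v$ a unit vector. Points "form an $\ell_i$" if they are such a configuration (a congruent copy of $\ell_i$). *)

theory Defs
  imports "HOL-Analysis.Analysis"
begin

datatype colour = Red | Blue

text \<open>A congruent copy of \<open>\<ell>\<^sub>i\<close>, for \<open>i \<ge> 1\<close>.\<close>

definition forms_ell :: "nat \<Rightarrow> (real ^ 3) set \<Rightarrow> bool" where
  "forms_ell i P \<longleftrightarrow>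
     (\<exists>p v. norm v = 1 \<and> P = (\<lambda>k. p + real k *\<^sub>R v) ` {0..<i})"

end

theory Submission
  imports Defs
begin

text \<open>
  Suppose that no two red points are at distance 1 and that every \<open>\<ell>\<^sub>5\<close> contains a red point.
  A red point \<open>A\<close> makes its whole unit sphere blue, and a line at distance \<open>sqrt 3 / 2\<close> from \<open>A\<close>
  meets this sphere in two points at distance 1. Two red points \<open>A\<close>, \<open>B\<close> can therefore
  account for four blue points of one \<open>\<ell>\<^sub>5\<close>, so that its fifth point must be red. Turning the picture
  about the axis \<open>AB\<close> moves this fifth point along a circle. If the radius of the circle is at
  least \<open>1/2\<close>, then it has a chord of length 1, so it is not entirely red: a contradiction.
  With suitable lines this argument shows that the distances \<open>2\<close>, \<open>sqrt 7\<close> and \<open>3\<close> do not occur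
  between red points (\<open>no_red_at_2\<close>, \<open>no_red_at_sqrt7\<close>, \<open>no_red_at_3\<close>).

  Once \<open>sqrt 7\<close> is excluded, distance \<open>4\<close> is impossible as well: on the parallel to \<open>AB\<close> at distance
  \<open>sqrt 3 / 2\<close> there are five consecutive points each of which is at distance \<open>1\<close> or \<open>sqrt 7\<close>
  from \<open>A\<close> or \<open>B\<close> (\<open>no_red_at_4\<close>).

  Hence, on any line through a red point \<open>A\<close>, the points at distances 1, 2, 3 and 4 from \<open>A\<close> are blue,
  and the next one must be red. So the sphere of radius 5 about \<open>A\<close> is entirely red, although it
  contains two points at distance 1.
\<close>

section \<open>Coordinates in a plane\<close>

definition plane_point :: "'a::real_inner \<Rightarrow> 'a \<Rightarrow> 'a \<Rightarrow> real \<Rightarrow> real \<Rightarrow> 'a" where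
  "plane_point A w n a b = A + a *\<^sub>R w + b *\<^sub>R n"

lemma norm_orthonormal_combination:
  fixes w n :: "'a::real_inner"
  assumes "norm w = 1" "norm n = 1" "w \<bullet> n = 0"
  shows "norm (a *\<^sub>R w + b *\<^sub>R n) = sqrt (a\<^sup>2 + b\<^sup>2)"
proof -
  have "w \<bullet> w = 1" "n \<bullet> n = 1" "n \<bullet> w = 0"
    using assms by (simp_all add: dot_square_norm inner_commute)
  then show ?thesis
    using assms by (simp add: norm_eq_sqrt_inner inner_add_left inner_add_right power2_eq_square)
qed

lemma dist_plane_point:
  fixes w n :: "'a::real_inner"
  assumes "norm w = 1" "norm n = 1" "w \<bullet> n = 0"
  shows "dist (plane_point A w n a b) (plane_point A w n a' b') = sqrt ((a - a')\<^sup>2 + (b - b')\<^sup>2)"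
proof -
  have "plane_point A w n a b - plane_point A w n a' b' = (a - a') *\<^sub>R w + (b - b') *\<^sub>R n"
    by (simp add: plane_point_def algebra_simps)
  then show ?thesis
    using norm_orthonormal_combination[OF assms] by (simp add: dist_norm)
qed

lemma exists_orthonormal_complement:
  fixes w :: "real ^ 3"
  assumes "norm w = 1"
  obtains e f where "norm e = 1" "norm f = 1" "e \<bullet> f = 0" "w \<bullet> e = 0" "w \<bullet> f = 0"
proof -
  obtain y where y: "y \<noteq> 0" "orthogonal w y"
    using orthogonal_to_vector_exists[of w] by auto
  define e where "e = y /\<^sub>R norm y"
  have e: "norm e = 1" "w \<bullet> e = 0"
    using y by (simp_all add: e_def orthogonal_def)
  have "(norm (cross3 w e))\<^sup>2 = 1"
    using assms e by (simp add: norm_cross)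
  then have "norm (cross3 w e) = 1"
    by (simp add: power2_eq_1_iff) (metis norm_ge_zero not_one_le_zero neg_0_le_iff_le)
  with e that[of e "cross3 w e"] show thesis
    by (simp add: dot_cross_self)
qed

section \<open>Colourings without a red unit distance and without a blue \<open>\<ell>\<^sub>5\<close>\<close>

locale no_red_pair_no_blue_ell5 =
  fixes c :: "real ^ 3 \<Rightarrow> colour"
  assumes red_not_unit: "c x = Red \<Longrightarrow> c y = Red \<Longrightarrow> dist x y \<noteq> 1"
    and red_on_ell5: "norm v = 1 \<Longrightarrow> \<exists>k<5::nat. c (p + real k *\<^sub>R v) = Red"
begin

lemma not_red_iff [simp]: "c x \<noteq> Red \<longleftrightarrow> c x = Blue"
  by (cases "c x") auto

text \<open>
  A circle of diameter at least 1 has a chord of length 1, whose endpoints cannot both be red.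
\<close>

lemma blue_on_circle:
  assumes "norm e = 1" "norm f = 1" "e \<bullet> f = 0" and r: "r \<ge> 1/2"
  obtains n a b where "n = a *\<^sub>R e + b *\<^sub>R f" "norm n = 1" "c (p + r *\<^sub>R n) = Blue"
proof -
  \<comment> \<open>The chord joins the points with coordinates \<open>r (a, b)\<close> and \<open>r (a, - b)\<close>, so \<open>2 r b\<close> must be 1.\<close>
  define b where "b = 1 / (2 * r)"
  define a where "a = sqrt (1 - b\<^sup>2)"
  have b: "0 < b" "b \<le> 1" "2 * r * b = 1"
    using r by (simp_all add: b_def field_simps)
  then have ab: "a\<^sup>2 + b\<^sup>2 = 1"
    by (simp add: a_def power_le_one)
  have unit: "norm (a *\<^sub>R e + b *\<^sub>R f) = 1" "norm (a *\<^sub>R e + (- b) *\<^sub>R f) = 1"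
    using norm_orthonormal_combination[OF assms(1-3), of a b]
      norm_orthonormal_combination[OF assms(1-3), of a "- b"] ab by simp_all
  have "(p + r *\<^sub>R (a *\<^sub>R e + b *\<^sub>R f)) - (p + r *\<^sub>R (a *\<^sub>R e + (- b) *\<^sub>R f)) = (2 * r * b) *\<^sub>R f"
    by (simp add: algebra_simps flip: scaleR_add_left)
  then have "dist (p + r *\<^sub>R (a *\<^sub>R e + b *\<^sub>R f)) (p + r *\<^sub>R (a *\<^sub>R e + (- b) *\<^sub>R f)) = 1"
    using b assms(2) by (simp add: dist_norm)
  then have "c (p + r *\<^sub>R (a *\<^sub>R e + b *\<^sub>R f)) = Blue \<or> c (p + r *\<^sub>R (a *\<^sub>R e + (- b) *\<^sub>R f)) = Blue"
    using red_not_unit not_red_iff by blast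
  then show thesis
    using that unit by blast
qed

text \<open>
  The form in which rotation about an axis is used: instead of turning a configuration, one
  chooses the half-plane through the axis \<open>w\<close> so that a prescribed point of it is blue.
\<close>

lemma blue_around_axis:
  assumes w: "norm w = 1" and r: "r \<ge> 1/2"
  obtains n where "norm n = 1" "w \<bullet> n = 0" "c (plane_point A w n s r) = Blue"
proof -
  obtain e f where ef: "norm e = 1" "norm f = 1" "e \<bullet> f = 0" "w \<bullet> e = 0" "w \<bullet> f = 0"
    using exists_orthonormal_complement[OF w] .
  obtain n a b where "n = a *\<^sub>R e + b *\<^sub>R f" "norm n = 1" "c ((A + s *\<^sub>R w) + r *\<^sub>R n) = Blue"
    using blue_on_circle[OF ef(1-3) r] .
  with ef that[of n] show thesis
    by (simp add: plane_point_def inner_add_right)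
qed

lemma blue_at_unit_distance:
  assumes "norm w = 1" "norm n = 1" "w \<bullet> n = 0"
    and "c (plane_point A w n a b) = Red" and "(a - a')\<^sup>2 + (b - b')\<^sup>2 = 1"
  shows "c (plane_point A w n a' b') = Blue"
  using red_not_unit dist_plane_point[OF assms(1-3)] assms(4,5) not_red_iff
  by (metis real_sqrt_one)

lemma red_on_plane_ell5:
  assumes "norm w = 1" "norm n = 1" "w \<bullet> n = 0" and "x\<^sup>2 + y\<^sup>2 = 1"
    and "c (plane_point A w n a b) = Blue"
    and "c (plane_point A w n (a + x) (b + y)) = Blue"
    and "c (plane_point A w n (a + 2 * x) (b + 2 * y)) = Blue"
    and "c (plane_point A w n (a + 3 * x) (b + 3 * y)) = Blue"
  shows "c (plane_point A w n (a + 4 * x) (b + 4 * y)) = Red"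
proof -
  have shift: "plane_point A w n a b + real k *\<^sub>R (x *\<^sub>R w + y *\<^sub>R n)
      = plane_point A w n (a + real k * x) (b + real k * y)" for k
    by (simp add: plane_point_def algebra_simps)
  have "norm (x *\<^sub>R w + y *\<^sub>R n) = 1"
    using norm_orthonormal_combination[OF assms(1-3)] assms(4) by simp
  from red_on_ell5[OF this, of "plane_point A w n a b"]
  obtain k :: nat where "k < 5" and k: "c (plane_point A w n (a + real k * x) (b + real k * y)) = Red"
    unfolding shift by blast
  from \<open>k < 5\<close> consider "k = 0" | "k = 1" | "k = 2" | "k = 3" | "k = 4"
    by linarith
  then show ?thesis
    using k assms(5-) by cases simp_all
qed

section \<open>Excluded distances between red points\<close>

text \<open>
  On a parallel to \<open>AB\<close> at distance \<open>sqrt 3 / 2\<close>, the points with abscissae \<open>-1/2\<close>, \<open>1/2\<close> lie on the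
  unit sphere of \<open>A\<close>, and those with abscissae \<open>3/2\<close>, \<open>5/2\<close> on the unit sphere of \<open>B\<close>. The parallel
  is chosen so that the point with abscissa \<open>-3/2\<close> is blue.
\<close>

lemma no_red_at_2:
  assumes A: "c A = Red" and w: "norm w = 1"
  shows "c (A + 2 *\<^sub>R w) = Blue"
proof (rule ccontr)
  assume "c (A + 2 *\<^sub>R w) \<noteq> Blue"
  then have "c (A + 2 *\<^sub>R w) = Red"
    using not_red_iff by blast
  define h where "h = sqrt 3 / 2"
  have h: "h\<^sup>2 = 3/4" "h \<ge> 1/2"
    by (simp_all add: h_def power_divide)
  obtain n where n: "norm n = 1" "w \<bullet> n = 0" and blue: "c (plane_point A w n (- 3/2) h) = Blue"
    using blue_around_axis[OF w h(2)] .
  have red: "c (plane_point A w n 0 0) = Red" "c (plane_point A w n 2 0) = Red"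
    using A \<open>c (A + 2 *\<^sub>R w) = Red\<close> by (simp_all add: plane_point_def)
  note unit = red[THEN blue_at_unit_distance[OF w n]]
  have blues: "c (plane_point A w n (- 1/2) h) = Blue" "c (plane_point A w n (1/2) h) = Blue"
    "c (plane_point A w n (3/2) h) = Blue" "c (plane_point A w n (5/2) h) = Blue"
    by (rule unit, simp add: h power_divide)+
  show False
    using red_on_plane_ell5[OF w n, of 1 0 A "- 3/2" h] blue blues by simp
qed

text \<open>
  Here the line passes through the midpoint of \<open>AB\<close> and has distance \<open>sqrt 3 / 2\<close> from both points, which
  lie on opposite sides of it. In units of \<open>1 / (2 * sqrt 7)\<close>, with \<open>A\<close> as the origin, \<open>B\<close> is
  \<open>(14, 0)\<close> and the five points are \<open>(-3, 5 * sqrt 3)\<close>, \<open>(1, 3 * sqrt 3)\<close>, \<open>(5, sqrt 3)\<close>,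
  \<open>(9, - sqrt 3)\<close>, \<open>(13, - 3 * sqrt 3)\<close>. Since \<open>1 + 27 = 25 + 3 = 28\<close>, the second and third have distance 1
  from \<open>A\<close>, and the last two have distance 1 from \<open>B\<close>; the first is made blue by the choice of the plane.
\<close>

lemma no_red_at_sqrt7:
  assumes A: "c A = Red" and w: "norm w = 1"
  shows "c (A + sqrt 7 *\<^sub>R w) = Blue"
proof (rule ccontr)
  assume "c (A + sqrt 7 *\<^sub>R w) \<noteq> Blue"
  then have "c (A + sqrt 7 *\<^sub>R w) = Red"
    using not_red_iff by blast
  define g h where "g = sqrt 7 / 14" and "h = sqrt 21 / 14"
  have g: "g\<^sup>2 = 1/28" and h: "h\<^sup>2 = 3/28"
    by (simp_all add: g_def h_def power_divide)
  have r: "5 * h \<ge> 1/2"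
  proof -
    have "sqrt 21 \<ge> 2"
      by (rule real_le_rsqrt) simp
    then show ?thesis
      by (simp add: h_def)
  qed
  obtain n where n: "norm n = 1" "w \<bullet> n = 0" and blue: "c (plane_point A w n (- 3 * g) (5 * h)) = Blue"
    using blue_around_axis[OF w r] .
  have red: "c (plane_point A w n 0 0) = Red" "c (plane_point A w n (14 * g) 0) = Red"
    using A \<open>c (A + sqrt 7 *\<^sub>R w) = Red\<close> by (simp_all add: plane_point_def g_def)
  note unit = red[THEN blue_at_unit_distance[OF w n]]
  have blues: "c (plane_point A w n g (3 * h)) = Blue" "c (plane_point A w n (5 * g) h) = Blue"
    "c (plane_point A w n (9 * g) (- h)) = Blue" "c (plane_point A w n (13 * g) (- 3 * h)) = Blue"
    by (rule unit, simp add: g h power_mult_distrib flip: left_diff_distrib)+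
  have "(4 * g)\<^sup>2 + (- 2 * h)\<^sup>2 = 1"
    by (simp add: g h power_mult_distrib)
  from red_on_plane_ell5[OF w n this, of A "- 3 * g" "5 * h"] blue blues
  show False
    by simp
qed

text \<open>
  As for distance 2, but now the unit spheres of \<open>A\<close> and \<open>B\<close> account for the abscissae \<open>-1/2\<close>, \<open>1/2\<close> and
  \<open>5/2\<close>, \<open>7/2\<close>, and the parallel is chosen so that the middle point is blue.
\<close>

lemma no_red_at_3:
  assumes A: "c A = Red" and w: "norm w = 1"
  shows "c (A + 3 *\<^sub>R w) = Blue"
proof (rule ccontr)
  assume "c (A + 3 *\<^sub>R w) \<noteq> Blue"
  then have "c (A + 3 *\<^sub>R w) = Red"
    using not_red_iff by blast
  define h where "h = sqrt 3 / 2"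
  have h: "h\<^sup>2 = 3/4" "h \<ge> 1/2"
    by (simp_all add: h_def power_divide)
  obtain n where n: "norm n = 1" "w \<bullet> n = 0" and blue: "c (plane_point A w n (3/2) h) = Blue"
    using blue_around_axis[OF w h(2)] .
  have red: "c (plane_point A w n 0 0) = Red" "c (plane_point A w n 3 0) = Red"
    using A \<open>c (A + 3 *\<^sub>R w) = Red\<close> by (simp_all add: plane_point_def)
  note unit = red[THEN blue_at_unit_distance[OF w n]]
  have blues: "c (plane_point A w n (- 1/2) h) = Blue" "c (plane_point A w n (1/2) h) = Blue"
    "c (plane_point A w n (5/2) h) = Blue" "c (plane_point A w n (7/2) h) = Blue"
    by (rule unit, simp add: h power_divide)+
  show False
    using red_on_plane_ell5[OF w n, of 1 0 A "- 1/2" h] blue blues by simp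
qed

text \<open>
  Any parallel to \<open>AB\<close> at distance \<open>sqrt 3 / 2\<close> works here: for the points with abscissae \<open>3/2\<close> and
  \<open>5/2\<close> the distances to \<open>B\<close> and to \<open>A\<close>, respectively, are \<open>sqrt (25/4 + 3/4) = sqrt 7\<close>.
\<close>

lemma no_red_at_4:
  assumes A: "c A = Red" and w: "norm w = 1"
  shows "c (A + 4 *\<^sub>R w) = Blue"
proof (rule ccontr)
  assume "c (A + 4 *\<^sub>R w) \<noteq> Blue"
  then have "c (A + 4 *\<^sub>R w) = Red"
    using not_red_iff by blast
  define h where "h = sqrt 3 / 2"
  have h: "h\<^sup>2 = 3/4"
    by (simp_all add: h_def power_divide)
  obtain n where n: "norm n = 1" "w \<bullet> n = 0"
    using exists_orthonormal_complement[OF w] by metis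
  have red: "c (plane_point A w n 0 0) = Red" "c (plane_point A w n 4 0) = Red"
    using A \<open>c (A + 4 *\<^sub>R w) = Red\<close> by (simp_all add: plane_point_def)
  note unit = red[THEN blue_at_unit_distance[OF w n]]
  have far: "c (plane_point A w n a' b') = Blue"
    if "c (plane_point A w n a 0) = Red" "(a' - a)\<^sup>2 + b'\<^sup>2 = 7" for a a' b'
  proof -
    define u where "u = ((a' - a) / sqrt 7) *\<^sub>R w + (b' / sqrt 7) *\<^sub>R n"
    have "norm u = 1"
      using that(2) norm_orthonormal_combination[OF w n]
      by (simp add: u_def power_divide flip: add_divide_distrib)
    moreover have "plane_point A w n a 0 + sqrt 7 *\<^sub>R u = plane_point A w n a' b'"
      by (simp add: u_def plane_point_def scaleR_add_right scaleR_diff_left)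
    ultimately show ?thesis
      using no_red_at_sqrt7[OF that(1)] by metis
  qed
  have blues: "c (plane_point A w n (- 1/2) h) = Blue" "c (plane_point A w n (1/2) h) = Blue"
    "c (plane_point A w n (7/2) h) = Blue"
    by (rule unit, simp add: h power_divide)+
  have "c (plane_point A w n (3/2) h) = Blue" "c (plane_point A w n (5/2) h) = Blue"
    by (rule red[THEN far], simp add: h power_divide)+
  with red_on_plane_ell5[OF w n, of 1 0 A "- 1/2" h] blues
  show False
    by simp
qed

lemma red_at_5:
  assumes A: "c A = Red" and v: "norm v = 1"
  shows "c (A + 5 *\<^sub>R v) = Red"
proof -
  have "dist A (A + v) = 1"
    using v by (simp add: dist_norm)
  then have blue: "c (A + v) = Blue"
    using red_not_unit[OF A] not_red_iff by blast
  obtain k :: nat where "k < 5" and k: "c ((A + v) + real k *\<^sub>R v) = Red"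
    using red_on_ell5[OF v] by blast
  have "(A + v) + real k *\<^sub>R v = A + (1 + real k) *\<^sub>R v"
    by (simp add: algebra_simps)
  with k have k': "c (A + (1 + real k) *\<^sub>R v) = Red"
    by simp
  from \<open>k < 5\<close> consider "k = 0" | "k = 1" | "k = 2" | "k = 3" | "k = 4"
    by linarith
  then show ?thesis
    using k' blue no_red_at_2[OF A v] no_red_at_3[OF A v] no_red_at_4[OF A v] by cases simp_all
qed

lemma contradiction: False
proof -
  obtain w :: "real ^ 3" where w: "norm w = 1"
    using vector_choose_size[of 1] by auto
  then obtain A where A: "c A = Red"
    using red_on_ell5 by blast
  obtain e f :: "real ^ 3" where "norm e = 1" "norm f = 1" "e \<bullet> f = 0"
    using exists_orthonormal_complement[OF w] by metis
  then obtain n where "norm n = 1" "c (A + 5 *\<^sub>R n) = Blue"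
    using blue_on_circle[of e f 5 A] by auto
  with red_at_5[OF A] show False
    by simp
qed

end

section \<open>Existence of a blue \<open>\<ell>\<^sub>5\<close>\<close>

theorem theorem2p1:
  fixes c :: "real ^ 3 \<Rightarrow> colour"
  assumes "\<not> (\<exists>x y. c x = Red \<and> c y = Red \<and> dist x y = 1)"
  shows "\<exists>P. forms_ell 5 P \<and> (\<forall>x\<in>P. c x = Blue)"
proof (rule ccontr)
  assume no_ell5: "\<not> ?thesis"
  interpret no_red_pair_no_blue_ell5 c
  proof
    show "dist x y \<noteq> 1" if "c x = Red" "c y = Red" for x y
      using assms that by blast
  next
    fix p v :: "real ^ 3"
    assume "norm v = 1"
    then have "forms_ell 5 ((\<lambda>k. p + real k *\<^sub>R v) ` {0..<5})"
      unfolding forms_ell_def by blast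
    with no_ell5 obtain k :: nat where "k < 5" "c (p + real k *\<^sub>R v) \<noteq> Blue"
      by auto
    then show "\<exists>k<5::nat. c (p + real k *\<^sub>R v) = Red"
      using colour.exhaust by blast
  qed
  show False
    by (rule contradiction)
qed

end
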